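(* Let $s>2$ be an integer, $A=\{0,1,\dots,s-1\}$, and let $p_0,p_1,\dots,p_{s-1}$ be positive real numbers with $p_0+p_1+\dots+p_{s-1}=1$. Let $\{\tau_1,\tau_2,\dots,\tau_m\}$ be a fixed finite set of combinations of digits (nonempty finite words) over the alphabet $A$, and let $E$ be the set of all numbers in $[0,1]$ whose P-representation is formed only by these combinations, i.e. $$E=\left\{x: x=\Delta^{P}_{\tau'_1\tau'_2\ldots\tau'_n\ldots},\ \tau'_n\in\{\tau_1,\dots,\tau_m\}\text{ for all }n\ge1\right\},$$ where the digit sequence is the infinite concatenation of the words $\tau'_1,\tau'_2,\dots$. Then the Hausdorff dimension $\alpha_0$ of $E$ satisfies the equation $$\sum_{j=1}^{m}\left(\prod_{i=0}^{s-1}p_i^{N_i(\tau_j)}\right)^{\alpha_0}=1,$$ where $N_i(\tau_j)$ is the number of occurrences of the digit $i$ in $\tau_j$.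
   Context: Put $\beta_0=0$ and $\beta_k=\sum_{i=0}^{k-1}p_i$ for $k\in\{1,\dots,s-1\}$. For a sequence $(a_n)_{n\ge1}$ of elements of $A$, write $$\Delta^{P}_{a_1a_2\ldots a_n\ldots}=\beta_{a_1}+\sum_{n=2}^{\infty}\Big(\beta_{a_n}\prod_{j=1}^{n-1}p_{a_j}\Big)\in[0,1];$$ this is called the P-representation of the number, where $P=\{p_0,\dots,p_{s-1}\}$.
   Formalization: It is assumed in addition that different finite sequences of the given words have different concatenations (unique decodability); otherwise the claim fails, e.g. for the words 0 and 00, where E={0} has dimension 0 but the sum at exponent 0 is 2. *)

theory Defs
  imports "HOL-Analysis.Analysis" "HOL-Library.Stream"
begin

text \<open>The \<open>a\<close>-dimensional size of a covering set. The case distinction fixes the convention that a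
  nonempty set has size 1 for \<open>a = 0\<close> (whereas \<^term>\<open>0 powr 0 = (0::real)\<close>), so that the
  0-dimensional measure is the counting measure.\<close>

definition hausdorff_size :: "real \<Rightarrow> 'a::metric_space set \<Rightarrow> ennreal" where
  "hausdorff_size a U =
     (if U = {} then 0 else if a = 0 then 1 else ennreal (diameter U powr a))"

text \<open>Boundedness is required explicitly because \<^const>\<open>diameter\<close> carries no information on
  unbounded sets.\<close>

definition hausdorff_pre_measure :: "real \<Rightarrow> real \<Rightarrow> 'a::metric_space set \<Rightarrow> ennreal" where
  "hausdorff_pre_measure a \<delta> E =
     (INF U \<in> {U :: nat \<Rightarrow> 'a set. E \<subseteq> (\<Union>i. U i) \<and> (\<forall>i. bounded (U i) \<and> diameter (U i) \<le> \<delta>)}.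
        \<Sum>i. hausdorff_size a (U i))"

text \<open>The supremum over \<open>\<delta> > 0\<close> is the limit for \<open>\<delta> \<rightarrow> 0\<close>, by monotonicity in \<open>\<delta>\<close>.\<close>

definition hausdorff_measure :: "real \<Rightarrow> 'a::metric_space set \<Rightarrow> ennreal" where
  "hausdorff_measure a E = (SUP \<delta> \<in> {0<..}. hausdorff_pre_measure a \<delta> E)"

definition hausdorff_dim :: "'a::metric_space set \<Rightarrow> ennreal" where
  "hausdorff_dim E = (INF a \<in> {a. 0 \<le> a \<and> hausdorff_measure a E = 0}. ennreal a)"

definition P_beta :: "(nat \<Rightarrow> real) \<Rightarrow> nat \<Rightarrow> real" where
  "P_beta p k = (\<Sum>i<k. p i)"

text \<open>Digit sequences are indexed from 0, so the summand for \<open>n = 0\<close> (with the empty product) is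
  the leading term \<open>P_beta p (d !! 0)\<close>.\<close>

definition P_number :: "(nat \<Rightarrow> real) \<Rightarrow> nat stream \<Rightarrow> real" where
  "P_number p d = (\<Sum>n. P_beta p (d !! n) * (\<Prod>j<n. p (d !! j)))"

text \<open>\<^const>\<open>flat\<close> is the infinite concatenation of a stream of words; it is meaningful only for
  nonempty words.\<close>

definition P_word_set :: "(nat \<Rightarrow> real) \<Rightarrow> nat list set \<Rightarrow> real set" where
  "P_word_set p T = {x. \<exists>ws \<in> streams T. x = P_number p (flat ws)}"

end

theory Submission
  imports Defs "HOL-Real_Asymp.Real_Asymp"
begin

text \<open>
  Write \<open>r\<^sub>w\<close> for the product of the \<open>p i\<close> over the digits \<open>i\<close> of a word \<open>w\<close>. Prefixing \<open>w\<close> to a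
  digit sequence acts on the represented number as an affine contraction
  \<open>x \<mapsto> l\<^sub>w + r\<^sub>w x\<close> of \<open>[0,1]\<close>, and different words of equal length give intervals
  \<open>[l\<^sub>w, l\<^sub>w + r\<^sub>w]\<close> without common interior points. The set in question is thus the attractor of
  the contractions belonging to the words of \<open>T\<close>, and the number \<open>\<alpha>\<close> with
  \<open>\<Sum>w\<in>T. r\<^sub>w powr \<alpha> = 1\<close>, which exists by the intermediate value theorem, is its similarity
  dimension. However, no separation condition is at hand: unique decodability says only that
  finite concatenations of words of \<open>T\<close> determine their factors, and one word may well be a prefix of
  another, so that intervals can be nested.

  The upper bound needs no separation: for \<open>a > \<alpha>\<close> the intervals of the concatenations of \<open>n\<close> words
  cover the set, and their total \<open>a\<close>-dimensional size \<open>(\<Sum>w\<in>T. r\<^sub>w powr a) ^ n\<close> tends to 0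
  (\<open>hausdorff_measure_P_word_set_eq_0\<close>).

  For the lower bound let \<open>a < \<alpha>\<close> and split the \<open>n\<close>-tuples of words according to how often they
  contain each word of \<open>T\<close>. There are only polynomially many classes, so one of them carries at
  least a polynomially small part of the total weight \<open>\<Sum> r powr \<alpha> = 1\<close>. All concatenations
  from that class have the same length and the same ratio \<open>r\<close>, and they are pairwise different by
  unique decodability; hence their intervals do not overlap. Splitting by a residue modulo 3 as well
  makes the intervals separated by gaps of length \<open>r\<close>. As \<open>r powr (\<alpha> - a)\<close> is exponentially small in
  \<open>n\<close>, a class of \<open>M\<close> tuples with \<open>M * r powr a \<ge> 1\<close> is found (\<open>exists_uniform_subfamily\<close>).
  Reading the base \<open>M\<close> digits of \<open>y \<in> [0,1)\<close> as a sequence of tuples of this class defines a map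
  \<open>h\<close> into the set with \<open>\<bar>y - z\<bar> \<le> C * \<bar>h y - h z\<bar> powr a\<close>, and countable
  subadditivity of Lebesgue measure turns any cover of the set into a lower bound for its total size
  (\<open>hausdorff_measure_coded_neq_0\<close>, \<open>hausdorff_measure_neq_0I\<close>).
\<close>

section \<open>Criteria for null and non-null Hausdorff measure\<close>

text \<open>Finite covers suffice, because they can be padded with empty sets to sequences of sets.\<close>

lemma hausdorff_measure_eq_0I:
  fixes E :: "'a::metric_space set"
  assumes "a > 0"
    and cover: "\<And>\<delta> \<epsilon>. \<delta> > 0 \<Longrightarrow> \<epsilon> > 0 \<Longrightarrow> \<exists>(I :: 'i set) U. finite I \<and> E \<subseteq> (\<Union>i\<in>I. U i) \<and>
      (\<forall>i\<in>I. bounded (U i) \<and> diameter (U i) \<le> \<delta>) \<and> (\<Sum>i\<in>I. diameter (U i) powr a) \<le> \<epsilon>"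
  shows "hausdorff_measure a E = 0"
proof -
  have "hausdorff_pre_measure a \<delta> E \<le> 0 + ennreal \<epsilon>" if \<delta>: "\<delta> > 0" and \<epsilon>: "\<epsilon> > 0" for \<delta> \<epsilon> :: real
  proof -
    obtain I :: "'i set" and U where I: "finite I" and E: "E \<subseteq> (\<Union>i\<in>I. U i)"
      and U: "\<And>i. i \<in> I \<Longrightarrow> bounded (U i) \<and> diameter (U i) \<le> \<delta>"
      and le: "(\<Sum>i\<in>I. diameter (U i) powr a) \<le> \<epsilon>"
      using cover[OF \<delta> \<epsilon>] by blast
    obtain e where e: "bij_betw e {0..<card I} I"
      using ex_bij_betw_nat_finite[OF I] by blast
    define V where "V n = (if n < card I then U (e n) else {})" for n
    have eI: "e n \<in> I" if "n < card I" for n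
      using e that by (auto simp: bij_betw_def)
    have "\<exists>n. x \<in> V n" if "x \<in> E" for x
    proof -
      obtain i where i: "i \<in> I" "x \<in> U i"
        using E \<open>x \<in> E\<close> by blast
      then have "i \<in> e ` {0..<card I}"
        using e by (simp add: bij_betw_imp_surj_on)
      then obtain n where "n < card I" "e n = i"
        by auto
      then show ?thesis
        using i by (auto simp: V_def intro!: exI[of _ n])
    qed
    moreover have "bounded (V n) \<and> diameter (V n) \<le> \<delta>" for n
      using U[OF eI, of n] \<delta> by (auto simp: V_def)
    ultimately have "hausdorff_pre_measure a \<delta> E \<le> (\<Sum>n. hausdorff_size a (V n))"
      unfolding hausdorff_pre_measure_def by (intro INF_lower) auto
    also have "\<dots> = (\<Sum>n\<in>{0..<card I}. hausdorff_size a (V n))"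
      by (rule suminf_finite) (auto simp: V_def hausdorff_size_def)
    also have "\<dots> = (\<Sum>n\<in>{0..<card I}. hausdorff_size a (U (e n)))"
      by (rule sum.cong) (auto simp: V_def)
    also have "\<dots> = (\<Sum>i\<in>I. hausdorff_size a (U i))"
      by (rule sum.reindex_bij_betw[OF e])
    also have "\<dots> \<le> (\<Sum>i\<in>I. ennreal (diameter (U i) powr a))"
      using \<open>a > 0\<close> by (intro sum_mono) (auto simp: hausdorff_size_def)
    also have "\<dots> = ennreal (\<Sum>i\<in>I. diameter (U i) powr a)"
      by (rule sum_ennreal) simp
    finally show ?thesis
      using le by (simp add: ennreal_leI order.trans)
  qed
  then have "hausdorff_pre_measure a \<delta> E \<le> 0" if "\<delta> > 0" for \<delta>
    by (rule ennreal_le_epsilon) (use that in simp)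
  then have "hausdorff_measure a E \<le> 0"
    unfolding hausdorff_measure_def by (intro SUP_least) simp
  then show ?thesis
    by simp
qed

lemma hausdorff_measure_0_nonempty:
  fixes E :: "'a::metric_space set"
  assumes "E \<noteq> {}"
  shows "hausdorff_measure 0 E \<noteq> 0"
proof -
  have "1 \<le> hausdorff_pre_measure 0 1 E"
    unfolding hausdorff_pre_measure_def
  proof (rule INF_greatest)
    fix U :: "nat \<Rightarrow> 'a set"
    assume "U \<in> {U. E \<subseteq> (\<Union>i. U i) \<and> (\<forall>i. bounded (U i) \<and> diameter (U i) \<le> 1)}"
    then obtain i where "U i \<noteq> {}"
      using assms by blast
    then have "1 = (\<Sum>n\<in>{i}. hausdorff_size 0 (U n))"
      by (simp add: hausdorff_size_def)
    also have "\<dots> \<le> (\<Sum>n. hausdorff_size 0 (U n))"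
      by (rule sum_le_suminf) auto
    finally show "1 \<le> (\<Sum>n. hausdorff_size 0 (U n))" .
  qed
  also have "\<dots> \<le> hausdorff_measure 0 E"
    unfolding hausdorff_measure_def by (rule SUP_upper) simp
  finally show ?thesis
    by (metis not_one_le_zero)
qed

text \<open>A form of the mass distribution principle: the mass is Lebesgue measure on \<open>[0,1)\<close>, carried
  to \<open>E\<close> by a map whose inverse is Hoelder continuous with exponent \<open>a\<close>.\<close>

lemma hausdorff_measure_neq_0I:
  fixes h :: "real \<Rightarrow> 'a::metric_space"
  assumes "a > 0" "C > 0" and E: "\<And>y. y \<in> {0..<1} \<Longrightarrow> h y \<in> E"
    and expand: "\<And>y z. y \<in> {0..<1} \<Longrightarrow> z \<in> {0..<1} \<Longrightarrow> \<bar>y - z\<bar> \<le> C * dist (h y) (h z) powr a"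
  shows "hausdorff_measure a E \<noteq> 0"
proof -
  have "ennreal (1 / (2 * C)) \<le> hausdorff_pre_measure a 1 E"
    unfolding hausdorff_pre_measure_def
  proof (rule INF_greatest)
    fix U :: "nat \<Rightarrow> 'a set"
    assume "U \<in> {U. E \<subseteq> (\<Union>i. U i) \<and> (\<forall>i. bounded (U i) \<and> diameter (U i) \<le> 1)}"
    then have cov: "E \<subseteq> (\<Union>i. U i)" and bdd: "\<And>i. bounded (U i)"
      by auto
    define A where "A i = {y \<in> {0..<1}. h y \<in> U i}" for i
    \<comment> \<open>An interval around the preimage of \<open>U i\<close>, of length comparable to \<open>diameter (U i) powr a\<close>.\<close>
    define J where "J i = (if A i = {} then {} else
      let y = SOME y. y \<in> A i; c = C * diameter (U i) powr a in {y - c .. y + c})" for i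
    have AJ: "A i \<subseteq> J i" for i
    proof
      fix z assume z: "z \<in> A i"
      define y where "y = (SOME y. y \<in> A i)"
      have y: "y \<in> A i"
        unfolding y_def using z by (metis someI)
      have "dist (h y) (h z) \<le> diameter (U i)"
        using y z bdd[of i] by (intro diameter_bounded_bound) (auto simp: A_def)
      then have "dist (h y) (h z) powr a \<le> diameter (U i) powr a"
        using \<open>a > 0\<close> by (intro powr_mono2) auto
      then have "\<bar>y - z\<bar> \<le> C * diameter (U i) powr a"
        using expand[of y z] y z \<open>C > 0\<close>
        by (smt (verit) A_def mem_Collect_eq mult_le_cancel_left_pos)
      then have "z \<in> {y - C * diameter (U i) powr a .. y + C * diameter (U i) powr a}"
        by auto
      then show "z \<in> J i"
        using z by (auto simp: J_def Let_def y_def[symmetric])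
    qed
    have Jle: "emeasure lborel (J i) \<le> ennreal (2 * C) * hausdorff_size a (U i)" for i
    proof (cases "A i = {}")
      case False
      then have "U i \<noteq> {}"
        by (auto simp: A_def)
      with False \<open>a > 0\<close> \<open>C > 0\<close> show ?thesis
        by (simp add: J_def Let_def hausdorff_size_def flip: ennreal_mult)
    qed (simp add: J_def)
    have "1 = emeasure lborel {0..<1::real}"
      by simp
    also have "\<dots> \<le> emeasure lborel (\<Union>i. J i)"
    proof (rule emeasure_mono)
      show "{0..<1} \<subseteq> (\<Union>i. J i)"
      proof
        fix y :: real assume y: "y \<in> {0..<1}"
        then obtain i where "h y \<in> U i"
          using E[OF y] cov by blast
        then show "y \<in> (\<Union>i. J i)"
          using AJ[of i] y by (auto simp: A_def)
      qed
    qed (auto simp: J_def Let_def)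
    also have "\<dots> \<le> (\<Sum>i. emeasure lborel (J i))"
      by (rule emeasure_subadditive_countably) (auto simp: J_def Let_def)
    also have "\<dots> \<le> (\<Sum>i. ennreal (2 * C) * hausdorff_size a (U i))"
      using Jle by (intro suminf_le) auto
    also have "\<dots> = ennreal (2 * C) * (\<Sum>i. hausdorff_size a (U i))"
      by simp
    finally have "ennreal (1 / (2 * C)) * 1 \<le> ennreal (1 / (2 * C)) * (ennreal (2 * C) * (\<Sum>i. hausdorff_size a (U i)))"
      by (intro mult_left_mono) auto
    also have "\<dots> = (\<Sum>i. hausdorff_size a (U i))"
      using \<open>C > 0\<close> by (simp add: mult.assoc[symmetric] flip: ennreal_mult)
    finally show "ennreal (1 / (2 * C)) \<le> (\<Sum>i. hausdorff_size a (U i))"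
      by simp
  qed
  also have "\<dots> \<le> hausdorff_measure a E"
    unfolding hausdorff_measure_def by (rule SUP_upper) simp
  finally show ?thesis
    using \<open>C > 0\<close> by (auto simp: ennreal_eq_0_iff)
qed

section \<open>Attractors of equally contracting, separated similarities\<close>

text \<open>Here \<open>\<pi>\<close> is the coding map of the similarities \<open>u \<mapsto> left x + r * u\<close>, which all have
  ratio \<open>r\<close>. They map \<open>[0,1]\<close> to intervals that lie at distance at least \<open>r\<close> from each other.\<close>

lemma hausdorff_measure_coded_neq_0:
  fixes \<pi> :: "'b stream \<Rightarrow> real" and left :: "'b \<Rightarrow> real"
  assumes "finite X" and r: "0 < r" "r < 1" and "a > 0"
    and card: "real (card X) * r powr a \<ge> 1"
    and \<pi>_Stream: "\<And>x t. x \<in> X \<Longrightarrow> t \<in> streams X \<Longrightarrow> \<pi> (x ## t) = left x + r * \<pi> t"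
    and \<pi>_unit: "\<And>t. t \<in> streams X \<Longrightarrow> \<pi> t \<in> {0..1}"
    and sep: "\<And>x y. x \<in> X \<Longrightarrow> y \<in> X \<Longrightarrow> x \<noteq> y \<Longrightarrow> \<bar>left x - left y\<bar> \<ge> 2 * r"
    and E: "\<pi> ` streams X \<subseteq> E"
  shows "hausdorff_measure a E \<noteq> 0"
proof -
  define M where "M = real (card X)"
  have ra: "r powr a < 1"
    using powr_less_mono2[of a r 1] r \<open>a > 0\<close> by simp
  have M1: "M > 1"
  proof (rule ccontr)
    assume "\<not> M > 1"
    then have "M * r powr a \<le> 1 * r powr a"
      by (intro mult_right_mono) auto
    then show False
      using card ra by (simp add: M_def)
  qed
  obtain e where e: "bij_betw e {0..<card X} X"
    using ex_bij_betw_nat_finite[OF \<open>finite X\<close>] by blast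
  \<comment> \<open>\<open>code y\<close> is the expansion of \<open>y\<close> in base \<open>M\<close>, with digits renamed to elements of \<open>X\<close>.\<close>
  define dig where "dig y = nat \<lfloor>M * y\<rfloor>" for y
  define code where "code y = smap (\<lambda>z. e (dig z)) (siterate (\<lambda>z. frac (M * z)) y)" for y
  have code_Stream: "code y = e (dig y) ## code (frac (M * y))" for y
    unfolding code_def by (subst siterate.ctr) simp
  have frac: "frac (M * y) \<in> {0..<1}" for y
    by (simp add: frac_lt_1)
  have dig_less: "dig y < card X" if "y \<in> {0..<1}" for y
  proof -
    have "M * y < M"
      using that M1 by simp
    then have "\<lfloor>M * y\<rfloor> < int (card X)"
      unfolding floor_less_iff by (simp add: M_def)
    then show ?thesis
      using that M1 unfolding dig_def by (simp add: nat_less_iff)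
  qed
  have eX: "e (dig y) \<in> X" if "y \<in> {0..<1}" for y
    using e dig_less[OF that] by (auto simp: bij_betw_def)
  have code_in: "code y \<in> streams X" if "y \<in> {0..<1}" for y
  proof -
    have "((\<lambda>z. frac (M * z)) ^^ n) y \<in> {0..<1}" for n
      using that frac by (cases n) auto
    then show ?thesis
      unfolding streams_iff_sset code_def using eX by (auto simp: stream.set_map sset_siterate)
  qed
  define h where "h y = \<pi> (code y)" for y
  have h_eq: "h y = left (e (dig y)) + r * h (frac (M * y))" if "y \<in> {0..<1}" for y
    unfolding h_def by (subst code_Stream) (use \<pi>_Stream eX[OF that] code_in[OF frac] in auto)
  have h_unit: "h y \<in> {0..1}" if "y \<in> {0..<1}" for y
    unfolding h_def using \<pi>_unit code_in[OF that] by blast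
  define C where "C = r powr - a"
  have C: "C > 0" "C * r powr a = 1"
    using r by (auto simp: C_def powr_minus field_simps)
  \<comment> \<open>A common first digit scales \<open>\<bar>y - z\<bar>\<close> by \<open>1 / M\<close> and the right-hand side by
    \<open>r powr a \<ge> 1 / M\<close>, which preserves the inequality; different first digits give
    \<open>\<bar>h y - h z\<bar> \<ge> r\<close>. The second alternative is for arguments with \<open>n\<close> common digits.\<close>
  have approx: "\<bar>y - z\<bar> \<le> C * \<bar>h y - h z\<bar> powr a \<or> \<bar>y - z\<bar> \<le> (1 / M) ^ n"
    if "y \<in> {0..<1}" "z \<in> {0..<1}" for y z n
    using that
  proof (induction n arbitrary: y z)
    case 0
    then show ?case by auto
  next
    case (Suc n)
    let ?y = "frac (M * y)" and ?z = "frac (M * z)"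
    show ?case
    proof (cases "dig y = dig z")
      case True
      have "\<lfloor>M * y\<rfloor> = \<lfloor>M * z\<rfloor>"
        using True Suc.prems M1 by (simp add: dig_def nat_eq_iff)
      then have "?y - ?z = M * (y - z)"
        by (simp add: frac_def algebra_simps)
      then have yz: "\<bar>y - z\<bar> = \<bar>?y - ?z\<bar> / M"
        using M1 by (simp add: abs_mult)
      have "h y - h z = r * (h ?y - h ?z)"
        using h_eq Suc.prems True by (simp add: algebra_simps)
      then have hh: "\<bar>h y - h z\<bar> powr a = r powr a * \<bar>h ?y - h ?z\<bar> powr a"
        using r by (simp add: abs_mult powr_mult)
      from Suc.IH[OF frac frac, of y z] show ?thesis
      proof
        assume *: "\<bar>?y - ?z\<bar> \<le> C * \<bar>h ?y - h ?z\<bar> powr a"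
        have "\<bar>y - z\<bar> \<le> C * \<bar>h ?y - h ?z\<bar> powr a / M"
          unfolding yz using * M1 by (intro divide_right_mono) auto
        also have "\<dots> \<le> C * \<bar>h ?y - h ?z\<bar> powr a / M * (M * r powr a)"
          using mult_left_mono[of 1 "M * r powr a" "C * \<bar>h ?y - h ?z\<bar> powr a / M"] card C M1
          by (simp add: M_def)
        also have "\<dots> = C * \<bar>h y - h z\<bar> powr a"
          using M1 by (simp add: hh)
        finally show ?thesis ..
      next
        assume "\<bar>?y - ?z\<bar> \<le> (1 / M) ^ n"
        then have "\<bar>y - z\<bar> \<le> (1 / M) ^ Suc n"
          unfolding yz using M1 by (simp add: field_simps)
        then show ?thesis ..
      qed
    next
      case False
      have "e (dig y) \<noteq> e (dig z)"
        using False e dig_less Suc.prems by (auto simp: bij_betw_def inj_on_def)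
      then have s: "\<bar>left (e (dig y)) - left (e (dig z))\<bar> \<ge> 2 * r"
        using sep eX Suc.prems by blast
      have "\<bar>h ?y - h ?z\<bar> \<le> 1"
        using h_unit[OF frac, of y] h_unit[OF frac, of z] by auto
      then have "\<bar>r * (h ?y - h ?z)\<bar> \<le> r"
        using r by (simp add: abs_mult)
      moreover have "h y - h z = (left (e (dig y)) - left (e (dig z))) + r * (h ?y - h ?z)"
        using h_eq Suc.prems by (simp add: algebra_simps)
      ultimately have "r \<le> \<bar>h y - h z\<bar>"
        using s by linarith
      then have "C * r powr a \<le> C * \<bar>h y - h z\<bar> powr a"
        using r \<open>a > 0\<close> C by (intro mult_left_mono powr_mono2) auto
      then show ?thesis
        using C Suc.prems by auto
    qed
  qed
  have "\<bar>y - z\<bar> \<le> C * dist (h y) (h z) powr a" if "y \<in> {0..<1}" "z \<in> {0..<1}" for y z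
  proof (rule ccontr)
    assume neg: "\<not> ?thesis"
    then have "\<bar>y - z\<bar> \<le> (1 / M) ^ n" for n
      using approx[OF that, of n] by (simp add: dist_real_def)
    moreover have "(\<lambda>n. (1 / M) ^ n) \<longlonglongrightarrow> 0"
      using M1 by (intro LIMSEQ_power_zero) auto
    ultimately have "\<bar>y - z\<bar> \<le> 0"
      by (intro LIMSEQ_le_const) auto
    moreover have "0 \<le> C * dist (h y) (h z) powr a"
      using C by simp
    ultimately show False
      using neg by linarith
  qed
  then show ?thesis
    using code_in \<open>a > 0\<close> C E by (intro hausdorff_measure_neq_0I[of a C h]) (auto simp: h_def)
qed

section \<open>Auxiliary facts on sums, words and rounding\<close>

lemma pigeonhole_sum:
  fixes f :: "'a \<Rightarrow> real"
  assumes "finite X" "finite K" "K \<noteq> {}" "key ` X \<subseteq> K"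
  shows "\<exists>k\<in>K. sum f X \<le> real (card K) * (\<Sum>x | x \<in> X \<and> key x = k. f x)"
proof (rule ccontr)
  assume "\<not> ?thesis"
  then have "(\<Sum>k\<in>K. real (card K) * (\<Sum>x | x \<in> X \<and> key x = k. f x)) < (\<Sum>k\<in>K. sum f X)"
    using assms by (intro sum_strict_mono) (auto simp: not_le)
  then have "real (card K) * (\<Sum>k\<in>K. \<Sum>x | x \<in> X \<and> key x = k. f x) < real (card K) * sum f X"
    by (simp add: sum_distrib_left)
  then show False
    using sum.group[OF assms(1,2,4), of f] by simp
qed

lemma sum_prod_list_words:
  fixes f :: "'a \<Rightarrow> real"
  assumes "finite T"
  shows "(\<Sum>xs | set xs \<subseteq> T \<and> length xs = n. prod_list (map f xs)) = (\<Sum>x\<in>T. f x) ^ n"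
proof (induction n)
  case 0
  have "{xs. set xs \<subseteq> T \<and> length xs = 0} = {[]}"
    by auto
  then show ?case by simp
next
  case (Suc n)
  let ?L = "{xs. set xs \<subseteq> T \<and> length xs = n}"
  have "(\<Sum>xs | set xs \<subseteq> T \<and> length xs = Suc n. prod_list (map f xs))
    = (\<Sum>(xs, x)\<in>?L \<times> T. f x * prod_list (map f xs))"
    unfolding lists_length_Suc_eq by (subst sum.reindex) (auto simp: inj_on_def case_prod_unfold)
  also have "\<dots> = (\<Sum>xs\<in>?L. (\<Sum>x\<in>T. f x) * prod_list (map f xs))"
    by (simp add: sum.cartesian_product[symmetric] sum_distrib_right)
  also have "\<dots> = (\<Sum>x\<in>T. f x) * (\<Sum>xs\<in>?L. prod_list (map f xs))"
    by (simp add: sum_distrib_left)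
  finally show ?case
    using Suc by simp
qed


lemma prod_list_powr:
  assumes "\<And>x. x \<in> set xs \<Longrightarrow> (0::real) \<le> f x"
  shows "prod_list (map f xs) powr a = prod_list (map (\<lambda>x. f x powr a) xs)"
  using assms
proof (induction xs)
  case (Cons x xs)
  moreover have "prod_list (map f xs) \<ge> 0"
    using Cons.prems by (intro prod_list_nonneg) auto
  ultimately show ?case by (simp add: powr_mult)
qed simp

lemma flat_shift_words:
  assumes "\<And>w. w \<in> set xs \<Longrightarrow> w \<noteq> []"
  shows "flat (xs @- ws) = concat xs @- flat ws"
  using assms by (induction xs) auto

text \<open>Numbers at distance at least 1 have different floors; congruent ones then differ by at least 3.\<close>

lemma abs_diff_ge_2_of_floor_mod_3:
  fixes x y :: real
  assumes "\<bar>x - y\<bar> \<ge> 1" "\<lfloor>x\<rfloor> mod 3 = \<lfloor>y\<rfloor> mod 3"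
  shows "\<bar>x - y\<bar> \<ge> 2"
proof -
  have "\<lfloor>x\<rfloor> \<noteq> \<lfloor>y\<rfloor>"
    using assms(1) by linarith
  with assms(2) have "\<bar>\<lfloor>x\<rfloor> - \<lfloor>y\<rfloor>\<bar> \<ge> 3"
    by presburger
  then show ?thesis
    by linarith
qed

section \<open>The affine maps of words\<close>

text \<open>For every word \<open>w\<close>, the numbers whose digit sequence begins with \<open>w\<close> lie in the interval of
  length \<open>word_ratio p w\<close> with left end point \<open>word_left p w\<close>.\<close>

definition word_ratio :: "(nat \<Rightarrow> real) \<Rightarrow> nat list \<Rightarrow> real" where
  "word_ratio p w = prod_list (map p w)"

primrec word_left :: "(nat \<Rightarrow> real) \<Rightarrow> nat list \<Rightarrow> real" where
  "word_left p [] = 0"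
| "word_left p (i # w) = P_beta p i + p i * word_left p w"

lemma word_ratio_simps [simp]:
  "word_ratio p [] = 1"
  "word_ratio p (i # w) = p i * word_ratio p w"
  "word_ratio p (v @ w) = word_ratio p v * word_ratio p w"
  by (simp_all add: word_ratio_def)

lemma word_ratio_concat: "word_ratio p (concat xs) = prod_list (map (word_ratio p) xs)"
  by (induction xs) auto

lemma word_ratio_eq_prod_count:
  assumes "set w \<subseteq> {..<s}"
  shows "word_ratio p w = (\<Prod>i<s. p i ^ count_list w i)"
  using assms
proof (induction w)
  case (Cons x w)
  have "(\<Prod>i<s. p i ^ count_list (x # w) i) = (\<Prod>i<s. (if i = x then p i else 1) * p i ^ count_list w i)"
    by (rule prod.cong) auto
  also have "\<dots> = (\<Prod>i<s. if i = x then p i else 1) * word_ratio p w"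
    using Cons by (simp add: prod.distrib)
  also have "(\<Prod>i<s. if i = x then p i else 1) = p x"
    using Cons.prems by simp
  finally show ?case by simp
qed simp

text \<open>The digit weights of a P-representation with \<open>s\<close> digits. Having at least two digits makes all
  weights less than 1.\<close>

locale digit_weights =
  fixes s :: nat and p :: "nat \<Rightarrow> real"
  assumes s_gt_1: "1 < s"
    and p_pos: "\<And>i. i < s \<Longrightarrow> 0 < p i"
    and p_sum: "(\<Sum>i<s. p i) = 1"
begin

lemma p_less_1:
  assumes "i < s"
  shows "p i < 1"
proof -
  obtain j where j: "j < s" "j \<noteq> i"
    using s_gt_1 by (metis less_trans zero_less_one zero_neq_one)
  have "p i + p j = (\<Sum>k\<in>{i, j}. p k)"
    using j by simp
  also have "\<dots> \<le> (\<Sum>k<s. p k)"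
    using assms j p_pos by (intro sum_mono2) (auto intro: less_imp_le)
  finally show ?thesis
    using p_pos[OF j(1)] p_sum by linarith
qed

lemma P_beta_step:
  assumes "i < j" "j \<le> s"
  shows "P_beta p i + p i \<le> P_beta p j"
proof -
  have "P_beta p i + p i = (\<Sum>k<Suc i. p k)"
    by (simp add: P_beta_def)
  also have "\<dots> \<le> P_beta p j"
    unfolding P_beta_def using assms p_pos by (intro sum_mono2) (auto intro: less_imp_le)
  finally show ?thesis .
qed

lemma P_beta_le_1: "i < s \<Longrightarrow> P_beta p i + p i \<le> 1"
  using P_beta_step[of i s] p_sum by (simp add: P_beta_def)

lemma P_beta_nonneg: "i < s \<Longrightarrow> 0 \<le> P_beta p i"
  unfolding P_beta_def using p_pos by (intro sum_nonneg) (auto intro: less_imp_le)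

lemma word_ratio_pos: "set w \<subseteq> {..<s} \<Longrightarrow> 0 < word_ratio p w"
  by (induction w) (auto simp: p_pos)

lemma word_ratio_less_1:
  assumes "set w \<subseteq> {..<s}" "w \<noteq> []"
  shows "word_ratio p w < 1"
  using assms
proof (induction w)
  case (Cons i w)
  have "word_ratio p w \<le> 1"
    using Cons by (cases w) auto
  then have "p i * word_ratio p w \<le> p i"
    using Cons p_pos[of i] by simp
  then show ?case
    using Cons p_less_1[of i] by simp
qed simp

lemma word_left_bounds:
  "set w \<subseteq> {..<s} \<Longrightarrow> 0 \<le> word_left p w \<and> word_left p w + word_ratio p w \<le> 1"
proof (induction w)
  case (Cons i w)
  then have i: "i < s" and w: "0 \<le> word_left p w" "word_left p w + word_ratio p w \<le> 1"
    by auto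
  have "p i * (word_left p w + word_ratio p w) \<le> p i"
    using w(2) p_pos[OF i] by simp
  then show ?case
    using P_beta_le_1[OF i] P_beta_nonneg[OF i] p_pos[OF i] w by (simp add: algebra_simps)
qed simp

lemma word_intervals_disjoint:
  assumes "length v = length w" "set v \<subseteq> {..<s}" "set w \<subseteq> {..<s}" "v \<noteq> w"
  shows "word_left p v + word_ratio p v \<le> word_left p w \<or>
    word_left p w + word_ratio p w \<le> word_left p v"
  using assms
proof (induction v w rule: list_induct2)
  case (Cons i v j w)
  have less: "P_beta p i + p i * word_left p v + p i * word_ratio p v \<le> P_beta p j + p j * word_left p w"
    if "i < j" "i < s" "j < s" "set v \<subseteq> {..<s}" "set w \<subseteq> {..<s}" for i j v w
  proof -
    have "p i * (word_left p v + word_ratio p v) \<le> p i" "0 \<le> p j * word_left p w"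
      using word_left_bounds that p_pos[of i] p_pos[of j] by auto
    then show ?thesis
      using P_beta_step[of i j] that by (simp add: algebra_simps)
  qed
  show ?case
  proof (cases "i = j")
    case True
    then have "word_left p v + word_ratio p v \<le> word_left p w \<or>
      word_left p w + word_ratio p w \<le> word_left p v" and i: "p i > 0"
      using Cons p_pos by auto
    then have "p i * (word_left p v + word_ratio p v) \<le> p i * word_left p w \<or>
      p i * (word_left p w + word_ratio p w) \<le> p i * word_left p v"
      by simp
    then show ?thesis
      using True by (simp add: algebra_simps)
  next
    case False
    then consider "i < j" | "j < i"
      by linarith
    then show ?thesis
      using less[of i j v w] less[of j i w v] Cons.prems by cases (simp_all add: algebra_simps)
  qed
qed simp

text \<open>The product is the length of the interval of the numbers that share the first \<open>N\<close> digits, and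
  the sum is its left end point.\<close>

lemma P_number_partial_sum:
  assumes "d \<in> streams {..<s}"
  shows "(\<Sum>n<N. P_beta p (d !! n) * (\<Prod>j<n. p (d !! j))) + (\<Prod>j<N. p (d !! j)) \<le> 1"
proof (induction N)
  case (Suc N)
  have d: "d !! n < s" for n
    using assms by (auto simp: streams_iff_snth)
  have "(P_beta p (d !! N) + p (d !! N)) * (\<Prod>j<N. p (d !! j)) \<le> 1 * (\<Prod>j<N. p (d !! j))"
    using d p_pos P_beta_le_1 by (intro mult_right_mono prod_nonneg) (auto intro: less_imp_le)
  then show ?case
    using Suc by (simp add: algebra_simps)
qed simp

lemma
  assumes "d \<in> streams {..<s}"
  shows P_number_summable: "summable (\<lambda>n. P_beta p (d !! n) * (\<Prod>j<n. p (d !! j)))"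
    and P_number_unit: "P_number p d \<in> {0..1}"
proof -
  have d: "d !! n < s" for n
    using assms by (auto simp: streams_iff_snth)
  have prod: "0 \<le> (\<Prod>j<n. p (d !! j))" for n
    using d p_pos by (intro prod_nonneg) (auto intro: less_imp_le)
  have nonneg: "0 \<le> P_beta p (d !! n) * (\<Prod>j<n. p (d !! j))" for n
    using P_beta_nonneg[OF d] prod by simp
  have le: "(\<Sum>n<N. P_beta p (d !! n) * (\<Prod>j<n. p (d !! j))) \<le> 1" for N
    using P_number_partial_sum[OF assms, of N] prod[of N] by linarith
  show *: "summable (\<lambda>n. P_beta p (d !! n) * (\<Prod>j<n. p (d !! j)))"
    using nonneg le by (rule summableI_nonneg_bounded)
  show "P_number p d \<in> {0..1}"
    unfolding P_number_def using suminf_nonneg[OF * nonneg] suminf_le_const[OF * le] by simp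
qed

lemma P_number_Stream:
  assumes "i < s" "d \<in> streams {..<s}"
  shows "P_number p (i ## d) = P_beta p i + p i * P_number p d"
proof -
  let ?f = "\<lambda>d n. P_beta p (d !! n) * (\<Prod>j<n. p (d !! j))"
  have "i ## d \<in> streams {..<s}"
    using assms by (simp add: streams_Stream)
  from suminf_split_head[OF P_number_summable[OF this]]
  have "P_number p (i ## d) = P_beta p i + (\<Sum>n. ?f (i ## d) (Suc n))"
    by (simp add: P_number_def del: prod.lessThan_Suc)
  also have "(\<lambda>n. ?f (i ## d) (Suc n)) = (\<lambda>n. p i * ?f d n)"
    by (simp add: prod.lessThan_Suc_shift mult_ac del: prod.lessThan_Suc)
  finally show ?thesis
    using P_number_summable[OF assms(2)] by (simp add: P_number_def suminf_mult)
qed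

lemma P_number_shift:
  assumes "set w \<subseteq> {..<s}" "d \<in> streams {..<s}"
  shows "P_number p (w @- d) = word_left p w + word_ratio p w * P_number p d"
  using assms
proof (induction w)
  case (Cons i w)
  then have "w @- d \<in> streams {..<s}"
    by (auto simp: streams_iff_sset)
  then show ?case
    using Cons by (simp add: P_number_Stream algebra_simps)
qed simp

end

section \<open>Sets generated by a finite family of words\<close>

text \<open>Unique decodability is no part of this locale: it is needed for the lower bound only.\<close>

locale word_family = digit_weights +
  fixes T :: "nat list set"
  assumes fin_T: "finite T" and T_nonempty: "T \<noteq> {}"
    and T_words: "\<And>w. w \<in> T \<Longrightarrow> w \<noteq> [] \<and> set w \<subseteq> {..<s}"
begin

lemma flat_in_streams:
  assumes "ws \<in> streams T"
  shows "flat ws \<in> streams {..<s}"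
proof -
  have "\<forall>w\<in>sset ws. w \<noteq> []"
    using assms T_words by (auto simp: streams_iff_sset)
  then show ?thesis
    using assms T_words by (auto simp: streams_iff_sset)
qed

lemma set_concat_words: "set xs \<subseteq> T \<Longrightarrow> set (concat xs) \<subseteq> {..<s}"
  using T_words by auto

lemma P_number_flat_shift:
  assumes "set xs \<subseteq> T" "ws \<in> streams T"
  shows "P_number p (flat (xs @- ws)) =
    word_left p (concat xs) + word_ratio p (concat xs) * P_number p (flat ws)"
proof -
  have "flat (xs @- ws) = concat xs @- flat ws"
    using assms T_words by (intro flat_shift_words) auto
  then show ?thesis
    using P_number_shift[OF set_concat_words flat_in_streams] assms by simp
qed

text \<open>The largest contraction ratio of the family.\<close>

definition max_ratio :: real where
  "max_ratio = Max (word_ratio p ` T)"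

lemma word_ratio_le_max: "w \<in> T \<Longrightarrow> word_ratio p w \<le> max_ratio"
  unfolding max_ratio_def using fin_T by simp

lemma word_ratio_T_pos: "w \<in> T \<Longrightarrow> 0 < word_ratio p w"
  using word_ratio_pos T_words by blast

lemma max_ratio: "0 < max_ratio" "max_ratio < 1"
proof -
  have "max_ratio \<in> word_ratio p ` T"
    unfolding max_ratio_def using fin_T T_nonempty by (intro Max_in) auto
  then show "0 < max_ratio" "max_ratio < 1"
    using T_words word_ratio_less_1 word_ratio_pos by auto
qed

lemma word_ratio_concat_le:
  assumes "set xs \<subseteq> T"
  shows "word_ratio p (concat xs) \<le> max_ratio ^ length xs"
  using assms
proof (induction xs)
  case (Cons w xs)
  then show ?case
    using word_ratio_le_max[of w] word_ratio_pos[OF set_concat_words[of xs]] max_ratio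
    by (auto intro!: mult_mono)
qed simp

lemma sum_word_ratio_concat_powr:
  "(\<Sum>xs | set xs \<subseteq> T \<and> length xs = n. word_ratio p (concat xs) powr a) =
    (\<Sum>w\<in>T. word_ratio p w powr a) ^ n"
proof -
  have "(\<Sum>xs | set xs \<subseteq> T \<and> length xs = n. word_ratio p (concat xs) powr a) =
    (\<Sum>xs | set xs \<subseteq> T \<and> length xs = n. prod_list (map (\<lambda>w. word_ratio p w powr a) xs))"
    unfolding word_ratio_concat using word_ratio_T_pos
    by (intro sum.cong prod_list_powr) (auto intro: less_imp_le)
  then show ?thesis
    by (simp add: sum_prod_list_words fin_T)
qed

lemma hausdorff_measure_P_word_set_eq_0:
  assumes "a > 0" and sub: "(\<Sum>w\<in>T. word_ratio p w powr a) < 1"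
  shows "hausdorff_measure a (P_word_set p T) = 0"
proof (rule hausdorff_measure_eq_0I)
  fix \<delta> \<epsilon> :: real assume pos: "\<delta> > 0" "\<epsilon> > 0"
  let ?S = "\<lambda>n. {xs. set xs \<subseteq> T \<and> length xs = n}"
  define U where "U xs = {word_left p (concat xs) .. word_left p (concat xs) + word_ratio p (concat xs)}"
    for xs
  have "(\<lambda>n. max_ratio ^ n) \<longlonglongrightarrow> 0" "(\<lambda>n. (\<Sum>w\<in>T. word_ratio p w powr a) ^ n) \<longlonglongrightarrow> 0"
    using max_ratio sub by (auto intro!: LIMSEQ_power_zero simp: sum_nonneg)
  then have "eventually (\<lambda>n. max_ratio ^ n < \<delta> \<and> (\<Sum>w\<in>T. word_ratio p w powr a) ^ n < \<epsilon>) sequentially"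
    using pos by (intro eventually_conj order_tendstoD(2)) auto
  then obtain n where n: "max_ratio ^ n < \<delta>" "(\<Sum>w\<in>T. word_ratio p w powr a) ^ n < \<epsilon>"
    by (auto simp: eventually_sequentially)
  have diam: "diameter (U xs) = word_ratio p (concat xs)" if "xs \<in> ?S n" for xs
    using that word_ratio_pos[OF set_concat_words[of xs]] by (simp add: U_def)
  have "finite (?S n)"
    using fin_T by (rule finite_lists_length_eq)
  moreover have "P_word_set p T \<subseteq> (\<Union>xs\<in>?S n. U xs)"
  proof
    fix x assume "x \<in> P_word_set p T"
    then obtain ws where ws: "ws \<in> streams T" "x = P_number p (flat ws)"
      by (auto simp: P_word_set_def)
    let ?xs = "stake n ws"
    have xs: "?xs \<in> ?S n" and tl: "sdrop n ws \<in> streams T"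
      using ws by (auto simp: streams_iff_snth in_set_conv_nth sdrop_snth)
    have "x = word_left p (concat ?xs) + word_ratio p (concat ?xs) * P_number p (flat (sdrop n ws))"
      using P_number_flat_shift[of ?xs "sdrop n ws"] xs tl ws by (simp add: stake_sdrop)
    moreover have "P_number p (flat (sdrop n ws)) \<in> {0..1}"
      using P_number_unit flat_in_streams tl by blast
    ultimately have "x \<in> U ?xs"
      using word_ratio_pos[OF set_concat_words[of ?xs]] xs by (auto simp: U_def mult_le_cancel_left1)
    then show "x \<in> (\<Union>xs\<in>?S n. U xs)"
      using xs by blast
  qed
  moreover have "bounded (U xs) \<and> diameter (U xs) \<le> \<delta>" if "xs \<in> ?S n" for xs
    using diam[OF that] word_ratio_concat_le[of xs] that n by (auto simp: U_def)
  moreover have "(\<Sum>xs\<in>?S n. diameter (U xs) powr a) \<le> \<epsilon>"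
  proof -
    have "(\<Sum>xs\<in>?S n. diameter (U xs) powr a) = (\<Sum>xs\<in>?S n. word_ratio p (concat xs) powr a)"
      using diam by (intro sum.cong) auto
    then show ?thesis
      using n(2) by (simp add: sum_word_ratio_concat_powr)
  qed
  ultimately show "\<exists>(I :: nat list list set) U. finite I \<and> P_word_set p T \<subseteq> (\<Union>i\<in>I. U i) \<and>
      (\<forall>i\<in>I. bounded (U i) \<and> diameter (U i) \<le> \<delta>) \<and> (\<Sum>i\<in>I. diameter (U i) powr a) \<le> \<epsilon>"
    by blast
qed (fact \<open>a > 0\<close>)

text \<open>The tuples in \<open>X\<close> play the role of the digits in \<open>hausdorff_measure_coded_neq_0\<close>.\<close>

lemma exists_uniform_subfamily:
  assumes inj: "inj_on concat (lists T)"
    and one: "(\<Sum>w\<in>T. word_ratio p w powr \<alpha>) = 1" and "a < \<alpha>"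
  obtains n X r where "0 < n" and "X \<subseteq> {xs. set xs \<subseteq> T \<and> length xs = n}"
    and "0 < r" and "r < 1" and "\<And>xs. xs \<in> X \<Longrightarrow> word_ratio p (concat xs) = r"
    and "real (card X) * r powr a \<ge> 1"
    and "\<And>xs ys. xs \<in> X \<Longrightarrow> ys \<in> X \<Longrightarrow> xs \<noteq> ys \<Longrightarrow>
      \<bar>word_left p (concat xs) - word_left p (concat ys)\<bar> \<ge> 2 * r"
proof -
  define m where "m = card T"
  define c where "c = max_ratio powr (\<alpha> - a)"
  have c: "0 < c" "c < 1"
    using max_ratio \<open>a < \<alpha>\<close> powr_less_mono2[of "\<alpha> - a" max_ratio 1] by (auto simp: c_def)
  have "(\<lambda>n. 3 * (real n + 1) ^ m * c ^ n) \<longlonglongrightarrow> 0"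
    using c by real_asymp
  then have "eventually (\<lambda>n. 3 * (real n + 1) ^ m * c ^ n < 1) sequentially"
    by (rule order_tendstoD) simp
  with eventually_gt_at_top[of 0]
  have "eventually (\<lambda>n. 0 < n \<and> 3 * (real n + 1) ^ m * c ^ n < 1) sequentially"
    by (rule eventually_conj)
  then obtain n where n: "0 < n" "3 * (real n + 1) ^ m * c ^ n < 1"
    by (auto simp: eventually_sequentially)
  define S where "S = {xs. set xs \<subseteq> T \<and> length xs = n}"
  have finS: "finite S"
    unfolding S_def using fin_T by (rule finite_lists_length_eq)
  \<comment> \<open>The counts determine the length and the ratio of the concatenation. Non-overlapping intervals of
    equal ratio \<open>r\<close> have left end points that differ by at least \<open>r\<close>; equal residues improve this
    to \<open>2 * r\<close>.\<close>
  define key where "key xs = (restrict (count_list xs) T,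
    \<lfloor>word_left p (concat xs) / word_ratio p (concat xs)\<rfloor> mod 3)" for xs
  define K where "K = (T \<rightarrow>\<^sub>E {..n}) \<times> {0..<3::int}"
  have cardK: "real (card K) = 3 * (real n + 1) ^ m"
    using fin_T by (simp add: K_def card_cartesian_product card_PiE m_def add.commute)
  have finK: "finite K"
    unfolding K_def using fin_T by (intro finite_cartesian_product finite_PiE) auto
  moreover have "K \<noteq> {}"
    using cardK by (auto simp: card_gt_0_iff)
  moreover have "key ` S \<subseteq> K"
    by (auto simp: key_def K_def S_def count_le_length)
  ultimately obtain k where k: "(\<Sum>xs\<in>S. word_ratio p (concat xs) powr \<alpha>) \<le>
      real (card K) * (\<Sum>xs | xs \<in> S \<and> key xs = k. word_ratio p (concat xs) powr \<alpha>)"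
    using pigeonhole_sum[OF finS] by blast
  define X where "X = {xs \<in> S. key xs = k}"
  have X: "1 \<le> real (card K) * (\<Sum>xs\<in>X. word_ratio p (concat xs) powr \<alpha>)"
    using k one by (simp add: S_def sum_word_ratio_concat_powr X_def)
  then have "X \<noteq> {}"
    by auto
  then obtain xs0 where xs0: "xs0 \<in> X"
    by blast
  define r where "r = word_ratio p (concat xs0)"
  have XS: "set xs \<subseteq> T" "length xs = n" if "xs \<in> X" for xs
    using that by (auto simp: X_def S_def)
  have mset_eq: "mset xs = mset xs0" if "xs \<in> X" for xs
  proof (rule multiset_eqI)
    fix w
    have "restrict (count_list xs) T = restrict (count_list xs0) T"
      using that xs0 by (auto simp: X_def key_def)
    then have "count_list xs w = count_list xs0 w" if "w \<in> T"
      using that by (metis restrict_apply')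
    then show "count (mset xs) w = count (mset xs0) w"
      using XS(1)[OF that] XS(1)[OF xs0]
      by (cases "w \<in> T") (simp add: count_mset, metis count_mset_0_iff subsetD)
  qed
  have ratio: "word_ratio p (concat xs) = r" if "xs \<in> X" for xs
    unfolding r_def word_ratio_concat using mset_eq[OF that]
    by (metis mset_map prod_mset_prod_list)
  have len: "length (concat xs) = length (concat xs0)" if "xs \<in> X" for xs
    unfolding length_concat using mset_eq[OF that]
    by (metis mset_map sum_mset_sum_list)
  have r_pos: "0 < r"
    unfolding r_def using XS[OF xs0] by (intro word_ratio_pos set_concat_words)
  have r_le: "r \<le> max_ratio ^ n"
    unfolding r_def using word_ratio_concat_le XS[OF xs0] by metis
  have r_less: "r < 1"
    using r_le n(1) max_ratio by (metis le_less_trans power_Suc_less_one gr0_implies_Suc)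
  have sep: "\<bar>word_left p (concat xs) - word_left p (concat ys)\<bar> \<ge> 2 * r"
    if "xs \<in> X" "ys \<in> X" "xs \<noteq> ys" for xs ys
  proof -
    let ?x = "word_left p (concat xs)" and ?y = "word_left p (concat ys)"
    have "concat xs \<noteq> concat ys"
      using inj that XS by (auto simp: inj_on_def lists_eq_set)
    moreover have "length (concat xs) = length (concat ys)"
      using len that by metis
    ultimately have "?x + word_ratio p (concat xs) \<le> ?y \<or> ?y + word_ratio p (concat ys) \<le> ?x"
      using XS that by (intro word_intervals_disjoint set_concat_words) auto
    then have "\<bar>?x - ?y\<bar> \<ge> r"
      using ratio that by auto
    then have "\<bar>?x / r - ?y / r\<bar> \<ge> 1"
      using r_pos by (simp add: diff_divide_distrib[symmetric])
    moreover have "\<lfloor>?x / r\<rfloor> mod 3 = \<lfloor>?y / r\<rfloor> mod 3"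
    proof -
      have "key xs = key ys"
        using that by (simp add: X_def)
      then show ?thesis
        using that by (simp add: key_def ratio)
    qed
    ultimately have "\<bar>?x / r - ?y / r\<bar> \<ge> 2"
      by (rule abs_diff_ge_2_of_floor_mod_3)
    then show ?thesis
      using r_pos by (simp add: diff_divide_distrib[symmetric] field_simps)
  qed
  have "r powr (\<alpha> - a) \<le> (max_ratio ^ n) powr (\<alpha> - a)"
    using r_le r_pos \<open>a < \<alpha>\<close> by (intro powr_mono2) auto
  also have "\<dots> = c ^ n"
    using powr_powr_swap[of max_ratio "real n" "\<alpha> - a"] max_ratio by (simp add: c_def powr_realpow)
  finally have rc: "r powr (\<alpha> - a) \<le> c ^ n" .
  have "1 \<le> real (card K) * (real (card X) * r powr \<alpha>)"
    using X ratio by (simp cong: sum.cong)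
  also have "r powr \<alpha> = r powr a * r powr (\<alpha> - a)"
    by (simp flip: powr_add)
  also have "real (card K) * (real (card X) * (r powr a * r powr (\<alpha> - a))) \<le>
      real (card K) * (real (card X) * (r powr a * c ^ n))"
    using rc by (intro mult_left_mono) auto
  also have "\<dots> = (real (card X) * r powr a) * (3 * (real n + 1) ^ m * c ^ n)"
    by (simp add: cardK)
  also have "\<dots> \<le> (real (card X) * r powr a) * 1"
    using n by (intro mult_left_mono) auto
  finally have "1 \<le> real (card X) * r powr a"
    by simp
  moreover have "X \<subseteq> {xs. set xs \<subseteq> T \<and> length xs = n}"
    by (auto simp: X_def S_def)
  ultimately show thesis
    using that[of n X r] n(1) r_pos r_less ratio sep by blast
qed

lemma hausdorff_measure_P_word_set_neq_0:
  assumes inj: "inj_on concat (lists T)"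
    and one: "(\<Sum>w\<in>T. word_ratio p w powr \<alpha>) = 1" and "0 \<le> a" "a < \<alpha>"
  shows "hausdorff_measure a (P_word_set p T) \<noteq> 0"
proof (cases "a = 0")
  case True
  \<comment> \<open>The coding argument requires a positive exponent.\<close>
  obtain w where "w \<in> T"
    using T_nonempty by blast
  then have "sconst w \<in> streams T"
    by (simp add: streams_iff_sset)
  then have "P_word_set p T \<noteq> {}"
    by (auto simp: P_word_set_def)
  then show ?thesis
    using True hausdorff_measure_0_nonempty by blast
next
  case False
  with \<open>0 \<le> a\<close> have "a > 0"
    by simp
  show ?thesis
  proof (rule exists_uniform_subfamily[OF inj one \<open>a < \<alpha>\<close>])
    fix n :: nat and X r
    assume n: "0 < n" and X: "X \<subseteq> {xs. set xs \<subseteq> T \<and> length xs = n}"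
      and r: "0 < r" "r < 1"
      and ratio: "\<And>xs. xs \<in> X \<Longrightarrow> word_ratio p (concat xs) = r"
      and card: "real (card X) * r powr a \<ge> 1"
      and sep: "\<And>xs ys. xs \<in> X \<Longrightarrow> ys \<in> X \<Longrightarrow> xs \<noteq> ys \<Longrightarrow>
        \<bar>word_left p (concat xs) - word_left p (concat ys)\<bar> \<ge> 2 * r"
    have flat_X: "flat t \<in> streams T" if "t \<in> streams X" for t
    proof -
      have sset: "set xs \<subseteq> T" "length xs = n" if "xs \<in> sset t" for xs
      proof -
        have "xs \<in> X"
          using that \<open>t \<in> streams X\<close> unfolding streams_iff_sset by blast
        then show "set xs \<subseteq> T" "length xs = n"
          using X by auto
      qed
      then have "\<forall>xs\<in>sset t. xs \<noteq> []"
        using n by fastforce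
      then show ?thesis
        using sset by (auto simp: streams_iff_sset)
    qed
    show ?thesis
    proof (rule hausdorff_measure_coded_neq_0[where X = X and r = r and
          \<pi> = "\<lambda>t. P_number p (flat (flat t))" and left = "\<lambda>xs. word_left p (concat xs)"])
      show "finite X"
        using finite_subset[OF X finite_lists_length_eq[OF fin_T]] .
      show "P_number p (flat (flat (xs ## t))) = word_left p (concat xs) + r * P_number p (flat (flat t))"
        if "xs \<in> X" "t \<in> streams X" for xs t
      proof -
        have "xs \<noteq> []" "set xs \<subseteq> T"
          using that X n by auto
        then show ?thesis
          using P_number_flat_shift[of xs "flat t"] flat_X[OF that(2)] ratio[OF that(1)] by simp
      qed
      show "P_number p (flat (flat t)) \<in> {0..1}" if "t \<in> streams X" for t
        using P_number_unit flat_in_streams flat_X that by blast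
      show "(\<lambda>t. P_number p (flat (flat t))) ` streams X \<subseteq> P_word_set p T"
        using flat_X by (auto simp: P_word_set_def)
    qed (use r \<open>a > 0\<close> card sep in auto)
  qed
qed

section \<open>The similarity dimension\<close>

lemma exists_similarity_dimension:
  "\<exists>\<alpha>\<ge>0. (\<Sum>w\<in>T. word_ratio p w powr \<alpha>) = 1"
proof -
  let ?\<phi> = "\<lambda>t. \<Sum>w\<in>T. word_ratio p w powr t"
  have "(\<lambda>n. real (card T) * max_ratio ^ n) \<longlonglongrightarrow> real (card T) * 0"
    using max_ratio by (intro tendsto_mult tendsto_const LIMSEQ_power_zero) auto
  then have "eventually (\<lambda>n. real (card T) * max_ratio ^ n < 1) sequentially"
    by (rule order_tendstoD) simp
  then obtain n where n: "real (card T) * max_ratio ^ n < 1"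
    by (auto simp: eventually_sequentially)
  have "?\<phi> (real n) = (\<Sum>w\<in>T. word_ratio p w ^ n)"
    using word_ratio_T_pos by (intro sum.cong) (auto simp: powr_realpow)
  also have "\<dots> \<le> real (card T) * max_ratio ^ n"
    using word_ratio_le_max word_ratio_T_pos
    by (intro sum_bounded_above power_mono) (auto intro: less_imp_le)
  finally have "?\<phi> (real n) \<le> 1"
    using n by simp
  moreover have "1 \<le> ?\<phi> 0"
  proof -
    have "?\<phi> 0 = (\<Sum>w\<in>T. 1)"
      using word_ratio_T_pos by (intro sum.cong) force+
    moreover have "card T \<ge> 1"
      using fin_T T_nonempty by (simp add: Suc_le_eq card_gt_0_iff)
    ultimately show ?thesis by simp
  qed
  moreover have "continuous_on {0..real n} ?\<phi>"
    using word_ratio_T_pos by (intro continuous_intros) force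
  ultimately obtain \<alpha> where "0 \<le> \<alpha>" "?\<phi> \<alpha> = 1"
    using IVT2'[of ?\<phi> "real n" 1 0] by auto
  then show ?thesis by blast
qed

lemma hausdorff_dim_P_word_set:
  assumes inj: "inj_on concat (lists T)"
    and one: "(\<Sum>w\<in>T. word_ratio p w powr \<alpha>) = 1" and "0 \<le> \<alpha>"
  shows "hausdorff_dim (P_word_set p T) = ennreal \<alpha>"
proof (rule antisym)
  show "hausdorff_dim (P_word_set p T) \<le> ennreal \<alpha>"
  proof (rule ennreal_le_epsilon)
    fix e :: real assume "e > 0"
    have "(\<Sum>w\<in>T. word_ratio p w powr (\<alpha> + e)) < (\<Sum>w\<in>T. word_ratio p w powr \<alpha>)"
      using fin_T T_nonempty \<open>e > 0\<close> word_ratio_T_pos word_ratio_less_1 T_words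
      by (intro sum_strict_mono powr_less_mono') auto
    then have "hausdorff_measure (\<alpha> + e) (P_word_set p T) = 0"
      using one \<open>e > 0\<close> \<open>0 \<le> \<alpha>\<close> by (intro hausdorff_measure_P_word_set_eq_0) auto
    then have "hausdorff_dim (P_word_set p T) \<le> ennreal (\<alpha> + e)"
      unfolding hausdorff_dim_def using \<open>e > 0\<close> \<open>0 \<le> \<alpha>\<close> by (intro INF_lower) auto
    then show "hausdorff_dim (P_word_set p T) \<le> ennreal \<alpha> + ennreal e"
      using \<open>e > 0\<close> \<open>0 \<le> \<alpha>\<close> by simp
  qed
  show "ennreal \<alpha> \<le> hausdorff_dim (P_word_set p T)"
    unfolding hausdorff_dim_def
  proof (rule INF_greatest)
    fix a assume "a \<in> {a. 0 \<le> a \<and> hausdorff_measure a (P_word_set p T) = 0}"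
    then have "\<not> a < \<alpha>"
      using hausdorff_measure_P_word_set_neq_0[OF inj one] by auto
    then show "ennreal \<alpha> \<le> ennreal a"
      by (intro ennreal_leI) simp
  qed
qed

end

theorem theorem5:
  fixes s :: nat and p :: "nat \<Rightarrow> real" and T :: "nat list set"
  assumes "s > 2"
    and "\<And>i. i < s \<Longrightarrow> p i > 0"
    and "(\<Sum>i<s. p i) = 1"
    and "finite T" and "T \<noteq> {}"
    and "\<And>w. w \<in> T \<Longrightarrow> w \<noteq> [] \<and> set w \<subseteq> {..<s}"
    and uniquely_decodable: "inj_on concat (lists T)"
  shows "\<exists>\<alpha>\<^sub>0\<ge>0. hausdorff_dim (P_word_set p T) = ennreal \<alpha>\<^sub>0 \<and>
           (\<Sum>w\<in>T. (\<Prod>i<s. p i ^ count_list w i) powr \<alpha>\<^sub>0) = 1"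
proof -
  interpret word_family s p T
    using assms by unfold_locales auto
  obtain \<alpha> where \<alpha>: "0 \<le> \<alpha>" "(\<Sum>w\<in>T. word_ratio p w powr \<alpha>) = 1"
    using exists_similarity_dimension by blast
  have "(\<Sum>w\<in>T. (\<Prod>i<s. p i ^ count_list w i) powr \<alpha>) = (\<Sum>w\<in>T. word_ratio p w powr \<alpha>)"
    using word_ratio_eq_prod_count[of _ s p] T_words by (intro sum.cong) auto
  then show ?thesis
    using \<alpha> hausdorff_dim_P_word_set[OF uniquely_decodable \<alpha>(2,1)] by auto
qed

end
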